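(* Let $\lambda\in\mathbb Z^n$ be a partition, let $v\in\lambda B_n$, and let $T$ be the tableau obtained by adding the column with entries $1,2,\dots,n$ (top to bottom) to the left of the key tableau $K(v)$. Then the window notation of the minimal length coset representative $\sigma_v$ is given by the column reading word of $T$, where entries with the same absolute value are read just once (at their first occurrence).
   Context: Fix $n\ge1$ and let $[\pm n]=\{1<\dots<n<\overline n<\dots<\overline1\}$, where $\overline i=-i$. $B_n$ is the hyperoctahedral group with Coxeter generators $s_1,\dots,s_n$ (with $(s_is_{i+1})^3=1$ for $1\le i\le n-2$, $(s_{n-1}s_n)^4=1$, and the other pairs commuting), seen as the group of odd bijections of $[\pm n]$, acting on the right (so products are composed from left to right), $s_i$ ($i<n$) exchanging $i$ and $i+1$, and $s_n$ exchanging $n$ and $\overline n$. The window notation of $\sigma$ is $[a_1\,a_2\dots a_n]$, $a_i=(i)\sigma$. $B_n$ acts on the right on $\mathbb Z^n$: $vs_i$ swaps the $i$-th and $(i+1)$-th entries of $v$ if $i<n$, and $vs_n$ changes the sign of the last entry. A partition is $\lambda\in\mathbb Z^n$ with $\lambda_1\ge\dots\ge\lambda_n\ge0$; $\lambda B_n$ is its orbit and $W_\lambda$ its stabilizer. For $v\in\lambda B_n$, $\sigma_v$ is the minimal length element of the right coset $\{\sigma\in B_n:\lambda\sigma=v\}$ of $W_\lambda$. For $v\in\mathbb Z^n$, $K(v)$ is the tableau whose columns are obtained by putting, for each $i\in[n]$, in the first $|v_i|$ columns the letter $i$ if $v_i>0$, or $\overline i$ if $v_i<0$; each column is sorted increasingly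 from top to bottom in the order of $[\pm n]$. The column reading word of a tableau is obtained by reading down columns, columns from right to left. For example, for $v=(3,\overline3,0,0,\overline2)$ one gets $\sigma_v=[1\,\overline2\,\overline5\,3\,4]$. *)

theory Defs
  imports "HOL-Combinatorics.Permutations"
begin

section \<open>The hyperoctahedral group\<close>

text \<open>
  The letter \<open>i\<close> barred is the integer \<open>- i\<close>.  Elements of \<open>B\<^sub>n\<close> are functions on the integers that fix
  everything outside the alphabet.
\<close>

definition alphabet :: "nat \<Rightarrow> int set" where
  "alphabet n = {i. i \<noteq> 0 \<and> \<bar>i\<bar> \<le> int n}"

definition B :: "nat \<Rightarrow> (int \<Rightarrow> int) set" where
  "B n = {\<sigma>. \<sigma> permutes alphabet n \<and> (\<forall>i. \<sigma> (- i) = - \<sigma> i)}"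

definition gen :: "nat \<Rightarrow> nat \<Rightarrow> int \<Rightarrow> int" where
  "gen n i = (if i = n then transpose (int n) (- int n)
     else transpose (int i) (int i + 1) \<circ> transpose (- int i) (- int i - 1))"

text \<open>
  Permutations act on the right, so a product is composed from left to right: the product of
  \<open>\<sigma>\<close> followed by \<open>\<tau>\<close> is \<open>\<tau> \<circ> \<sigma>\<close>, and in a word the first generator is applied first.
\<close>

definition word_prod :: "nat \<Rightarrow> nat list \<Rightarrow> int \<Rightarrow> int" where
  "word_prod n ws = fold (gen n) ws"

definition cox_length :: "nat \<Rightarrow> (int \<Rightarrow> int) \<Rightarrow> nat" where
  "cox_length n \<sigma> = (LEAST k. \<exists>ws. length ws = k \<and> set ws \<subseteq> {1..n} \<and> word_prod n ws = \<sigma>)"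

definition window :: "nat \<Rightarrow> (int \<Rightarrow> int) \<Rightarrow> int list" where
  "window n \<sigma> = map \<sigma> [1..int n]"

section \<open>The action on integer vectors\<close>

text \<open>
  A vector in \<open>\<int>\<^sup>n\<close> is a list of length \<open>n\<close>.  Its coordinates are numbered from 1 and extended oddly
  to negative indices.
\<close>

definition coord :: "int list \<Rightarrow> int \<Rightarrow> int" where
  "coord v i = sgn i * v ! (nat \<bar>i\<bar> - 1)"

text \<open>
  The unique right action of \<open>B\<^sub>n\<close> in which the generators act as in \<open>act_gen\<close> and \<open>act_gen_last\<close>
  below; see also \<open>act_comp\<close> and \<open>act_word_prod\<close>.
\<close>

definition act :: "nat \<Rightarrow> int list \<Rightarrow> (int \<Rightarrow> int) \<Rightarrow> int list" where
  "act n v \<sigma> = map (\<lambda>i. coord v (inv \<sigma> i)) [1..int n]"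

definition orbit :: "nat \<Rightarrow> int list \<Rightarrow> int list set" where
  "orbit n v = act n v ` B n"

definition is_partition :: "nat \<Rightarrow> int list \<Rightarrow> bool" where
  "is_partition n lam \<longleftrightarrow> length lam = n \<and> sorted_wrt (\<ge>) lam \<and> (\<forall>x\<in>set lam. 0 \<le> x)"

definition min_rep :: "nat \<Rightarrow> int list \<Rightarrow> int list \<Rightarrow> int \<Rightarrow> int" where
  "min_rep n lam v = (THE \<sigma>. is_arg_min (cox_length n) (\<lambda>\<sigma>. \<sigma> \<in> B n \<and> act n lam \<sigma> = v) \<sigma>)"

section \<open>Key tableaux and reading words\<close>

text \<open>
  The position of a letter in the order \<open>1 < \<dots> < n < - n < \<dots> < - 1\<close>.
\<close>

definition letter_pos :: "nat \<Rightarrow> int \<Rightarrow> int" where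
  "letter_pos n x = (if 0 < x then x else 2 * int n + 1 + x)"

text \<open>
  A tableau is the list of its columns from left to right, each column being listed from top to
  bottom.
\<close>

definition key_column :: "nat \<Rightarrow> int list \<Rightarrow> int \<Rightarrow> int list" where
  "key_column n v j =
     sort_key (letter_pos n) (map (\<lambda>i. sgn (coord v i) * i) (filter (\<lambda>i. j \<le> \<bar>coord v i\<bar>) [1..int n]))"

definition key_tableau :: "nat \<Rightarrow> int list \<Rightarrow> int list list" where
  "key_tableau n v = map (key_column n v) [1..Max (insert 0 (abs ` set v))]"

definition reading_word :: "int list list \<Rightarrow> int list" where
  "reading_word T = concat (rev T)"

primrec read_once :: "int list \<Rightarrow> int list" where
  "read_once [] = []"
| "read_once (x # xs) = x # filter (\<lambda>y. \<bar>y\<bar> \<noteq> \<bar>x\<bar>) (read_once xs)"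

section \<open>Consistency of the conventions\<close>

lemma letter_pos_order:
  "sorted_wrt (\<lambda>x y. letter_pos n x < letter_pos n y) ([1..int n] @ [- int n..- 1])"
proof -
  have "sorted_wrt (\<lambda>x y. letter_pos n x < letter_pos n y) [1..int n]"
    by (rule sorted_wrt_mono_rel[of _ "(<)"]) (auto simp: letter_pos_def)
  moreover have "sorted_wrt (\<lambda>x y. letter_pos n x < letter_pos n y) [- int n..- 1]"
    by (rule sorted_wrt_mono_rel[of _ "(<)"]) (auto simp: letter_pos_def)
  ultimately show ?thesis
    by (auto simp: sorted_wrt_append letter_pos_def)
qed

lemma gen_in_B:
  assumes "1 \<le> i" "i \<le> n"
  shows "gen n i \<in> B n"
proof -
  have "gen n i permutes alphabet n"
    using assms unfolding gen_def
    by (auto intro!: permutes_swap_id permutes_compose simp: alphabet_def)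
  moreover have "gen n i (- j) = - gen n i j" for j
    using assms by (auto simp: gen_def transpose_def)
  ultimately show ?thesis by (simp add: B_def)
qed

lemma gen_involution: "1 \<le> i \<Longrightarrow> gen n i \<circ> gen n i = id"
  by (rule ext) (auto simp: gen_def transpose_def)

lemma inv_gen: "1 \<le> i \<Longrightarrow> inv (gen n i) = gen n i"
  by (rule inv_unique_comp) (auto simp: gen_involution)

lemma length_act [simp]: "length (act n v \<sigma>) = n"
  by (simp add: act_def)

lemma act_nth: "k < n \<Longrightarrow> act n v \<sigma> ! k = coord v (inv \<sigma> (int k + 1))"
  by (simp add: act_def add.commute)

lemma act_gen:
  assumes "length v = n" "1 \<le> i" "i < n"
  shows "act n v (gen n i) = v[i - 1 := v ! i, i := v ! (i - 1)]"
proof (rule nth_equalityI)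
  fix k assume "k < length (act n v (gen n i))"
  then have k: "k < n" by simp
  have e: "act n v (gen n i) ! k = coord v (gen n i (int k + 1))"
    using assms k by (simp add: act_nth inv_gen)
  consider "k = i - 1" | "k = i" | "k \<noteq> i - 1" "k \<noteq> i" by blast
  then show "act n v (gen n i) ! k = v[i - 1 := v ! i, i := v ! (i - 1)] ! k"
    unfolding e using assms k
    by cases (auto simp: gen_def coord_def transpose_def of_nat_diff nat_add_distrib)
qed (use assms in simp)

lemma act_gen_last:
  assumes "length v = n" "1 \<le> n"
  shows "act n v (gen n n) = v[n - 1 := - (v ! (n - 1))]"
proof (rule nth_equalityI)
  fix k assume "k < length (act n v (gen n n))"
  then have k: "k < n" by simp
  have e: "act n v (gen n n) ! k = coord v (gen n n (int k + 1))"
    using assms k by (simp add: act_nth inv_gen)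
  show "act n v (gen n n) ! k = v[n - 1 := - (v ! (n - 1))] ! k"
    unfolding e using assms k
    by (cases "k = n - 1")
      (auto simp: gen_def coord_def transpose_def of_nat_diff nat_add_distrib)
qed (use assms in simp)

lemma coord_act:
  assumes "\<sigma> \<in> B n" "i \<in> alphabet n"
  shows "coord (act n v \<sigma>) i = coord v (inv \<sigma> i)"
proof -
  have p: "\<sigma> permutes alphabet n" and odd: "\<And>j. \<sigma> (- j) = - \<sigma> j"
    using assms by (auto simp: B_def)
  have inv_odd: "inv \<sigma> (- j) = - inv \<sigma> j" for j
    by (metis odd p permutes_inverses(1,2))
  have "nat \<bar>i\<bar> - 1 < n" "int (nat \<bar>i\<bar> - 1) + 1 = \<bar>i\<bar>"
    using assms(2) by (auto simp: alphabet_def)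
  then have "coord (act n v \<sigma>) i = sgn i * coord v (inv \<sigma> \<bar>i\<bar>)"
    by (simp add: coord_def[of "act n v \<sigma>"] act_nth)
  then show ?thesis
    using assms(2) inv_odd[of i] by (auto simp: alphabet_def abs_if coord_def sgn_minus)
qed

lemma act_comp:
  assumes "\<sigma> \<in> B n" "\<tau> \<in> B n"
  shows "act n v (\<tau> \<circ> \<sigma>) = act n (act n v \<sigma>) \<tau>"
proof -
  have p: "\<sigma> permutes alphabet n" "\<tau> permutes alphabet n"
    using assms by (auto simp: B_def)
  have "inv (\<tau> \<circ> \<sigma>) = inv \<sigma> \<circ> inv \<tau>"
    using p by (simp add: o_inv_distrib permutes_bij)
  moreover have "inv \<tau> i \<in> alphabet n" if "i \<in> {1..int n}" for i
    using permutes_in_image[OF permutes_inv[OF p(2)], of i] that by (auto simp: alphabet_def)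
  ultimately show ?thesis
    using assms by (auto simp: act_def[of _ v "\<tau> \<circ> \<sigma>"] act_def[of _ _ \<tau>] coord_act)
qed

lemma B_comp: "\<sigma> \<in> B n \<Longrightarrow> \<tau> \<in> B n \<Longrightarrow> \<tau> \<circ> \<sigma> \<in> B n"
  by (auto simp: B_def permutes_compose)

lemma word_prod_in_B:
  assumes "set ws \<subseteq> {1..n}"
  shows "word_prod n ws \<in> B n"
  using assms
proof (induction ws rule: rev_induct)
  case Nil
  then show ?case by (simp add: word_prod_def B_def id_def permutes_def)
next
  case (snoc i ws)
  then have "gen n i \<circ> word_prod n ws \<in> B n"
    by (auto intro!: B_comp gen_in_B)
  moreover have "word_prod n (ws @ [i]) = gen n i \<circ> word_prod n ws"
    by (auto simp: word_prod_def)
  ultimately show ?case by metis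
qed

lemma act_word_prod:
  assumes "length v = n" "set ws \<subseteq> {1..n}"
  shows "act n v (word_prod n ws) = fold (\<lambda>i u. act n u (gen n i)) ws v"
  using assms(2)
proof (induction ws rule: rev_induct)
  case Nil
  have "act n v id = v"
    using assms(1) by (intro nth_equalityI) (auto simp: act_nth coord_def nat_add_distrib)
  then show ?case by (simp add: word_prod_def id_def)
next
  case (snoc i ws)
  have "word_prod n (ws @ [i]) = gen n i \<circ> word_prod n ws"
    by (auto simp: word_prod_def)
  then have "act n v (word_prod n (ws @ [i])) = act n v (gen n i \<circ> word_prod n ws)"
    by metis
  also have "\<dots> = act n (act n v (word_prod n ws)) (gen n i)"
    using snoc.prems by (intro act_comp word_prod_in_B gen_in_B) auto
  finally show ?case using snoc by simp
qed

lemma key_example: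
  defines "v \<equiv> [3, - 3, 0, 0, - 2]"
  shows "key_tableau 5 v = [[1, - 5, - 2], [1, - 5, - 2], [1, - 2]]"
    and "read_once (reading_word ([1..5] # key_tableau 5 v)) = [1, - 2, - 5, 3, 4]"
  unfolding v_def by code_simp+

end

theory Submission imports Defs begin

text \<open>
  If \<open>\<sigma>\<close> inverts an adjacent pair of letters, the letter of a word for \<open>\<sigma>\<close> at which the images of this
  pair change order can be deleted; hence a minimal length element of the coset inverts no adjacent
  pair that is exchanged by a generator fixing \<open>\<lambda>\<close>.  Its window therefore lists the letters by
  decreasing coordinate of \<open>v\<close>, and increasingly among equal coordinates, those at
  coordinate \<open>0\<close> being positive.  Column by column, this is what reading each letter once produces:
  the letters that occur first in column \<open>j\<close> are those with coordinate exactly \<open>j\<close>, and the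
  additional column accounts for the coordinate \<open>0\<close>.
\<close>

section \<open>Reflections and deletion\<close>

text \<open>For \<open>y = - x\<close> the two transpositions coincide and would cancel, so only one
  is taken. This makes every reflection an odd map.\<close>

definition reflection :: "int \<Rightarrow> int \<Rightarrow> int \<Rightarrow> int" where
  "reflection x y = (if y = - x then transpose x y else transpose x y \<circ> transpose (- x) (- y))"

text \<open>The successor of \<open>i\<close> in the order of the alphabet, so that the generator at
  \<open>n\<close> is treated like the others.\<close>

definition next_letter :: "nat \<Rightarrow> nat \<Rightarrow> int" where
  "next_letter n i = (if i = n then - int n else int i + 1)"

lemma gen_eq_reflection: "1 \<le> i \<Longrightarrow> gen n i = reflection (int i) (next_letter n i)"
  by (auto simp: gen_def reflection_def next_letter_def)

lemma B_permutes: "\<sigma> \<in> B n \<Longrightarrow> \<sigma> permutes alphabet n"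
  by (simp add: B_def)

lemma B_minus: "\<sigma> \<in> B n \<Longrightarrow> \<sigma> (- i) = - \<sigma> i"
  by (simp add: B_def)

lemma B_alphabet: "\<sigma> \<in> B n \<Longrightarrow> \<sigma> i \<in> alphabet n \<longleftrightarrow> i \<in> alphabet n"
  by (simp add: B_permutes permutes_in_image)

lemma B_not_in: "\<sigma> \<in> B n \<Longrightarrow> i \<notin> alphabet n \<Longrightarrow> \<sigma> i = i"
  by (meson B_permutes permutes_not_in)

lemma B_inv:
  assumes "\<sigma> \<in> B n"
  shows "\<sigma> (inv \<sigma> i) = i" "inv \<sigma> (\<sigma> i) = i"
  using permutes_inverses[OF B_permutes[OF assms]] by auto

lemma B_eq_iff: "\<sigma> \<in> B n \<Longrightarrow> \<sigma> i = \<sigma> j \<longleftrightarrow> i = j"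
  by (meson B_permutes injD permutes_inj)

text \<open>Conjugation carries reflections to reflections; oddness and injectivity of \<sigma>
  preserve the case \<open>y = - x\<close>.\<close>

lemma B_comp_reflection:
  assumes "\<sigma> \<in> B n"
  shows "\<sigma> \<circ> reflection x y = reflection (\<sigma> x) (\<sigma> y) \<circ> \<sigma>"
proof -
  have transpose: "\<sigma> \<circ> transpose a b = transpose (\<sigma> a) (\<sigma> b) \<circ> \<sigma>" for a b
    using assms by (auto simp: fun_eq_iff transpose_def B_eq_iff)
  have "\<sigma> y = - \<sigma> x \<longleftrightarrow> y = - x"
    using B_eq_iff[OF assms, of y "- x"] by (simp add: B_minus[OF assms])
  moreover have "\<sigma> \<circ> (transpose x y \<circ> transpose (- x) (- y))
      = transpose (\<sigma> x) (\<sigma> y) \<circ> transpose (\<sigma> (- x)) (\<sigma> (- y)) \<circ> \<sigma>"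
    by (metis comp_assoc transpose)
  ultimately show ?thesis
    by (simp add: reflection_def transpose B_minus[OF assms])
qed

lemma letter_pos_inj:
  "x \<in> alphabet n \<Longrightarrow> y \<in> alphabet n \<Longrightarrow> letter_pos n x = letter_pos n y \<Longrightarrow> x = y"
  by (auto simp: letter_pos_def alphabet_def split: if_splits)

lemma letter_pos_ge_1: "x \<in> alphabet n \<Longrightarrow> 1 \<le> letter_pos n x"
  by (auto simp: letter_pos_def alphabet_def)

text \<open>A generator inverts only the adjacent letters it exchanges: \<open>n\<close> and
  \<open>- n\<close>, or else \<open>k\<close> and \<open>k + 1\<close> or their negatives. The last
  two pairs define the same reflection.\<close>

lemma gen_eq_reflection_of_inversion:
  assumes "x \<in> alphabet n" "y \<in> alphabet n" "1 \<le> k" "k \<le> n"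
    and "letter_pos n x < letter_pos n y" "letter_pos n (gen n k y) < letter_pos n (gen n k x)"
  shows "gen n k = reflection x y"
proof (cases "k = n")
  case True
  then have "x = int n \<and> y = - int n"
    using assms by (auto simp: gen_def transpose_def letter_pos_def alphabet_def split: if_splits)
  then show ?thesis using True by (auto simp: gen_def reflection_def)
next
  case False
  then have "(x = int k \<and> y = int k + 1) \<or> (x = - int k - 1 \<and> y = - int k)"
    using assms by (auto simp: gen_def transpose_def letter_pos_def alphabet_def split: if_splits)
  then show ?thesis
  proof (elim disjE conjE)
    assume "x = int k" "y = int k + 1"
    then show ?thesis using False by (simp add: gen_def reflection_def)
  next
    assume xy: "x = - int k - 1" "y = - int k"
    show ?thesis
    proof
      fix i
      show "gen n k i = reflection x y i"
        using False assms(3) unfolding xy by (simp add: gen_def reflection_def transpose_def)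
    qed
  qed
qed

lemma word_prod_Cons: "word_prod n (k # ws) = word_prod n ws \<circ> gen n k"
  by (simp add: word_prod_def)

text \<open>The strong exchange condition. The head of the word acts first: either it inverts the
  pair, hence is the reflection itself and cancels, or the images of the pair are inverted by the
  rest of the word.\<close>

lemma word_deletion:
  assumes "set ws \<subseteq> {1..n}" "x \<in> alphabet n" "y \<in> alphabet n"
    and "letter_pos n x < letter_pos n y"
    and "letter_pos n (word_prod n ws y) < letter_pos n (word_prod n ws x)"
  shows "\<exists>us. Suc (length us) = length ws \<and> set us \<subseteq> {1..n} \<and>
    word_prod n us = word_prod n ws \<circ> reflection x y"
  using assms
proof (induction ws arbitrary: x y)
  case Nil
  then show ?case by (simp add: word_prod_def)
next
  case (Cons k ws)
  let ?g = "gen n k"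
  have k: "1 \<le> k" "k \<le> n" using Cons.prems(1) by auto
  then have g: "?g \<in> B n" by (rule gen_in_B)
  show ?case
  proof (cases "letter_pos n (?g y) < letter_pos n (?g x)")
    case True
    then have "?g = reflection x y"
      using gen_eq_reflection_of_inversion Cons.prems k by blast
    then have "word_prod n (k # ws) \<circ> reflection x y = word_prod n ws"
      using gen_involution[of k n] k by (metis comp_assoc comp_id word_prod_Cons)
    then show ?thesis using Cons.prems(1) by (intro exI[of _ ws]) auto
  next
    case False
    then have "letter_pos n (?g x) < letter_pos n (?g y)"
      using Cons.prems(2-4) B_alphabet[OF g] B_eq_iff[OF g] letter_pos_inj
      by (metis less_irrefl linorder_less_linear)
    then obtain us where us: "Suc (length us) = length ws" "set us \<subseteq> {1..n}"
      "word_prod n us = word_prod n ws \<circ> reflection (?g x) (?g y)"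
      using Cons.IH[of "?g x" "?g y"] Cons.prems B_alphabet[OF g]
      by (metis comp_apply insert_subset list.simps(15) word_prod_Cons)
    \<comment> \<open>Conjugation by \<open>?g\<close> turns the reflection in the images back into
      the one in \<open>x\<close> and \<open>y\<close>.\<close>
    have "word_prod n (k # us) = word_prod n (k # ws) \<circ> reflection x y"
      by (simp only: word_prod_Cons us(3) comp_assoc B_comp_reflection[OF g])
    then show ?thesis using us Cons.prems(1) by (intro exI[of _ "k # us"]) auto
  qed
qed

section \<open>Descents\<close>

definition descent :: "nat \<Rightarrow> (int \<Rightarrow> int) \<Rightarrow> nat \<Rightarrow> bool" where
  "descent n \<sigma> i \<longleftrightarrow> letter_pos n (\<sigma> (next_letter n i)) < letter_pos n (\<sigma> (int i))"

lemma nat_in_alphabet: "1 \<le> i \<Longrightarrow> i \<le> n \<Longrightarrow> int i \<in> alphabet n"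
  by (simp add: alphabet_def)

lemma next_letter_in_alphabet: "1 \<le> i \<Longrightarrow> i \<le> n \<Longrightarrow> next_letter n i \<in> alphabet n"
  by (auto simp: alphabet_def next_letter_def)

lemma not_descentD:
  assumes "\<sigma> \<in> B n" "1 \<le> i" "i < n" "\<not> descent n \<sigma> i"
  shows "letter_pos n (\<sigma> (int i)) < letter_pos n (\<sigma> (int i + 1))"
proof -
  have "int i + 1 \<in> alphabet n" using assms by (simp add: alphabet_def)
  then have "letter_pos n (\<sigma> (int i)) \<noteq> letter_pos n (\<sigma> (int i + 1))"
    using assms letter_pos_inj[of "\<sigma> (int i)" n "\<sigma> (int i + 1)"]
    by (auto simp: B_alphabet B_eq_iff nat_in_alphabet)
  then show ?thesis using assms by (simp add: descent_def next_letter_def)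
qed

lemma descent_last_iff:
  assumes "\<sigma> \<in> B n" "1 \<le> n"
  shows "descent n \<sigma> n \<longleftrightarrow> \<sigma> (int n) < 0"
proof -
  have "\<sigma> (int n) \<in> alphabet n" using assms by (simp add: B_alphabet nat_in_alphabet)
  then show ?thesis
    using assms by (auto simp: descent_def next_letter_def B_minus letter_pos_def alphabet_def)
qed

section \<open>A weight that decreases when a descent is removed\<close>

lemma sum_update2:
  fixes f g :: "int \<Rightarrow> int"
  assumes "finite A" "a \<in> A" "b \<in> A" "a \<noteq> b" "\<And>k. k \<in> A \<Longrightarrow> k \<noteq> a \<Longrightarrow> k \<noteq> b \<Longrightarrow> g k = f k"
  shows "sum g A - sum f A = (g a - f a) + (g b - f b)"
proof -
  have "sum g A - sum f A = (\<Sum>k\<in>A. g k - f k)" by (simp add: sum_subtractf)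
  also have "\<dots> = (\<Sum>k\<in>{a, b}. g k - f k)"
    using assms by (intro sum.mono_neutral_right) auto
  finally show ?thesis using assms by simp
qed

text \<open>A termination measure for sorting the window. The coefficients decrease with the
  position, so swapping a descent lowers the sum; the last one is 1 rather than 0, so a sign change
  at the end lowers it too.\<close>

definition weight :: "nat \<Rightarrow> (int \<Rightarrow> int) \<Rightarrow> int" where
  "weight n \<sigma> = (\<Sum>k\<in>{1..int n}. (int n + 1 - k) * letter_pos n (\<sigma> k))"

lemma weight_nonneg:
  assumes "\<sigma> \<in> B n"
  shows "0 \<le> weight n \<sigma>"
  unfolding weight_def
proof (intro sum_nonneg mult_nonneg_nonneg)
  fix k assume "k \<in> {1..int n}"
  then have "k \<in> alphabet n" by (auto simp: alphabet_def)
  then have "\<sigma> k \<in> alphabet n" using assms by (simp add: B_alphabet)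
  then show "0 \<le> letter_pos n (\<sigma> k)" using letter_pos_ge_1[of "\<sigma> k" n] by simp
qed auto

lemma weight_less:
  assumes "\<sigma> \<in> B n" "1 \<le> i" "i \<le> n" "descent n \<sigma> i"
  shows "weight n (\<sigma> \<circ> gen n i) < weight n \<sigma>"
proof (cases "i = n")
  case True
  have "(\<Sum>k\<in>{1..int n}. (int n + 1 - k) * letter_pos n ((\<sigma> \<circ> gen n i) k))
      < (\<Sum>k\<in>{1..int n}. (int n + 1 - k) * letter_pos n (\<sigma> k))"
  proof (rule sum_strict_mono_ex1)
    show "\<forall>k\<in>{1..int n}. (int n + 1 - k) * letter_pos n ((\<sigma> \<circ> gen n i) k)
        \<le> (int n + 1 - k) * letter_pos n (\<sigma> k)"
      using True assms(4) by (auto simp: gen_def transpose_def descent_def next_letter_def)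
    show "\<exists>k\<in>{1..int n}. (int n + 1 - k) * letter_pos n ((\<sigma> \<circ> gen n i) k)
        < (int n + 1 - k) * letter_pos n (\<sigma> k)"
      using True assms(2,4) by (intro bexI[of _ "int n"])
        (auto simp: gen_def transpose_def descent_def next_letter_def)
  qed simp
  then show ?thesis by (simp add: weight_def)
next
  case False
  \<comment> \<open>The two coefficients involved differ by exactly 1.\<close>
  have "weight n (\<sigma> \<circ> gen n i) - weight n \<sigma>
      = letter_pos n (\<sigma> (int i + 1)) - letter_pos n (\<sigma> (int i))"
    unfolding weight_def using False assms(2,3)
    by (subst sum_update2[of _ "int i" "int i + 1"])
      (auto simp: gen_def transpose_def algebra_simps)
  then show ?thesis using False assms(4) by (auto simp: descent_def next_letter_def)
qed

section \<open>The window of a reduced element\<close>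

lemma read_once_append:
  "read_once (xs @ ys) = read_once xs @ filter (\<lambda>y. \<bar>y\<bar> \<notin> abs ` set xs) (read_once ys)"
  by (induction xs) (auto simp: conj_commute intro: filter_cong)

lemma read_once_distinct: "distinct (map abs xs) \<Longrightarrow> read_once xs = xs"
proof (induction xs)
  case (Cons x xs)
  have "\<bar>y\<bar> \<noteq> \<bar>x\<bar>" if "y \<in> set xs" for y
    using Cons.prems that by (metis distinct.simps(2) image_eqI list.set_map list.simps(9))
  then show ?case using Cons by simp
qed simp

lemma abs_set_read_once: "abs ` set (read_once xs) = abs ` set xs"
proof (induction xs)
  case (Cons x xs)
  have "abs ` set (read_once (x # xs)) = insert \<bar>x\<bar> (abs ` set (read_once xs))"
    by (auto simp: image_iff)
  then show ?case by (simp add: Cons)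
qed simp

text \<open>Since \<open>f\<close> decreases weakly along the list, the elements of value at least
  \<open>j + 1\<close> form an initial segment, directly followed by those of value
  \<open>j\<close>.\<close>

lemma filter_ge_split:
  fixes f :: "'a \<Rightarrow> int"
  assumes "sorted_wrt (\<lambda>a b. f b \<le> f a) xs"
  shows "filter (\<lambda>a. j \<le> f a) xs = filter (\<lambda>a. j + 1 \<le> f a) xs @ filter (\<lambda>a. f a = j) xs"
  using assms
proof (induction xs)
  case (Cons x xs)
  show ?case
  proof (cases "j + 1 \<le> f x")
    case False
    then have "filter (\<lambda>a. j + 1 \<le> f a) xs = []"
      using Cons.prems by (fastforce simp: filter_empty_conv)
    then show ?thesis using Cons False by auto
  qed (use Cons in auto)
qed simp

lemma sorted_wrt_key_unique:
  fixes key :: "'a \<Rightarrow> 'b::linorder"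
  assumes "sorted_wrt (\<lambda>a b. key a < key b) xs" "sorted_wrt (\<lambda>a b. key a < key b) ys"
    and "set xs = set ys"
  shows "xs = ys"
proof (rule map_inj_on)
  have s: "sorted_wrt (<) (map key xs)" "sorted_wrt (<) (map key ys)"
    using assms by (simp_all add: sorted_wrt_map)
  then show "map key xs = map key ys"
    using assms(3) by (intro strict_sorted_equal) auto
  have "distinct (map key xs)" using s strict_sorted_iff by blast
  then show "inj_on key (set xs \<union> set ys)" using assms(3) by (simp add: distinct_map)
qed

text \<open>
  \<open>f\<close> is the coordinate of \<open>v\<close> at a letter, \<open>w\<close> the window.  Appending a sorted column that contains
  all letters of coordinate at least \<open>j\<close> extends the prefix of \<open>w\<close> read so far.
\<close>

lemma read_once_append_column:
  fixes f key :: "int \<Rightarrow> int"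
  assumes w: "sorted_wrt (\<lambda>a b. f b < f a \<or> f a = f b \<and> key a < key b) w"
    and dw: "distinct (map abs w)"
    and u: "read_once u = filter (\<lambda>a. j + 1 \<le> f a) w"
    and col: "sorted_wrt (\<lambda>a b. key a < key b) col" "distinct (map abs col)"
    and set_col: "\<And>a. f a \<le> j \<or> a \<notin> set w \<Longrightarrow> \<bar>a\<bar> \<notin> abs ` {b \<in> set w. j + 1 \<le> f b}
       \<Longrightarrow> a \<in> set col \<longleftrightarrow> a \<in> set w \<and> f a = j"
  shows "read_once (u @ col) = filter (\<lambda>a. j \<le> f a) w"
proof -
  have abs_u: "abs ` set u = abs ` {b \<in> set w. j + 1 \<le> f b}"
    using abs_set_read_once[of u] by (simp add: u)
  \<comment> \<open>What the column contributes is sorted by \<open>key\<close>, as is the block of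
    coordinate \<open>j\<close> in \<open>w\<close>, so comparing sets suffices.
    \<open>set_col\<close> only concerns letters whose absolute value is still unread, which lets it
    cover the column \<open>[1..int n]\<close> as well.\<close>
  have eq: "filter (\<lambda>y. \<bar>y\<bar> \<notin> abs ` set u) col = filter (\<lambda>a. f a = j) w"
  proof (rule sorted_wrt_key_unique[where key = key])
    show "sorted_wrt (\<lambda>a b. key a < key b) (filter (\<lambda>y. \<bar>y\<bar> \<notin> abs ` set u) col)"
      using col(1) by (rule sorted_wrt_filter)
    have "sorted_wrt (\<lambda>a b. f b < f a \<or> f a = f b \<and> key a < key b) (filter (\<lambda>a. f a = j) w)"
      using w by (rule sorted_wrt_filter)
    then show "sorted_wrt (\<lambda>a b. key a < key b) (filter (\<lambda>a. f a = j) w)"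
      by (rule sorted_wrt_mono_rel[rotated]) auto
    have inj: "a = b" if "a \<in> set w" "b \<in> set w" "\<bar>a\<bar> = \<bar>b\<bar>" for a b
      using dw that by (auto simp: distinct_map dest: inj_onD)
    show "set (filter (\<lambda>y. \<bar>y\<bar> \<notin> abs ` set u) col) = set (filter (\<lambda>a. f a = j) w)"
    proof (intro set_eqI iffI)
      fix a assume a: "a \<in> set (filter (\<lambda>y. \<bar>y\<bar> \<notin> abs ` set u) col)"
      then have "f a \<le> j \<or> a \<notin> set w" unfolding set_filter abs_u by force
      then show "a \<in> set (filter (\<lambda>a. f a = j) w)"
        using a set_col[of a] by (simp add: abs_u)
    next
      fix a assume "a \<in> set (filter (\<lambda>a. f a = j) w)"
      then have a: "a \<in> set w" "f a = j" by auto
      have "\<bar>a\<bar> \<notin> abs ` {b \<in> set w. j + 1 \<le> f b}"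
      proof
        assume "\<bar>a\<bar> \<in> abs ` {b \<in> set w. j + 1 \<le> f b}"
        then obtain b where "b \<in> set w" "j + 1 \<le> f b" "\<bar>a\<bar> = \<bar>b\<bar>" by blast
        then show False using inj[of a b] a by simp
      qed
      then show "a \<in> set (filter (\<lambda>y. \<bar>y\<bar> \<notin> abs ` set u) col)"
        using a set_col[of a] by (simp add: abs_u)
    qed
  qed
  have "sorted_wrt (\<lambda>a b. f b \<le> f a) w"
    using w by (rule sorted_wrt_mono_rel[rotated]) auto
  then show ?thesis
    using filter_ge_split[of f w j] by (simp add: read_once_append read_once_distinct col u eq)
qed

text \<open>The two clauses run through the generators that fix \<open>lam\<close>: equal
  neighbouring entries, or a last entry 0.\<close>

definition reduced :: "nat \<Rightarrow> int list \<Rightarrow> (int \<Rightarrow> int) \<Rightarrow> bool" where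
  "reduced n lam \<sigma> \<longleftrightarrow>
     (\<forall>i. 1 \<le> i \<longrightarrow> i < n \<longrightarrow> lam ! (i - 1) = lam ! i \<longrightarrow> \<not> descent n \<sigma> i) \<and>
     (lam ! (n - 1) = 0 \<longrightarrow> \<not> descent n \<sigma> n)"

section \<open>Letters and coordinates along the window\<close>

lemma window_nth: "k < n \<Longrightarrow> window n \<sigma> ! k = \<sigma> (int k + 1)"
  by (simp add: window_def add.commute)

lemma length_window [simp]: "length (window n \<sigma>) = n"
  by (simp add: window_def)

lemma set_window_alphabet: "\<sigma> \<in> B n \<Longrightarrow> set (window n \<sigma>) \<subseteq> alphabet n"
  by (auto simp: window_def B_alphabet) (auto simp: alphabet_def)

lemma distinct_abs_window:
  assumes "\<sigma> \<in> B n"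
  shows "distinct (map abs (window n \<sigma>))"
proof -
  have "inj_on (abs \<circ> \<sigma>) {1..int n}"
  proof (rule inj_onI)
    fix i j assume "i \<in> {1..int n}" "j \<in> {1..int n}" "(abs \<circ> \<sigma>) i = (abs \<circ> \<sigma>) j"
    then show "i = j"
      using assms by (auto simp: abs_eq_iff B_eq_iff simp flip: B_minus)
  qed
  then show ?thesis by (simp add: window_def distinct_map)
qed

lemma window_or_minus:
  assumes "\<sigma> \<in> B n" "i \<in> alphabet n"
  shows "i \<in> set (window n \<sigma>) \<or> - i \<in> set (window n \<sigma>)"
proof -
  define k where "k = inv \<sigma> i"
  have k: "\<sigma> k = i" using assms(1) by (simp add: k_def B_inv)
  then have "k \<in> alphabet n" using assms B_alphabet by metis
  then have "k \<in> {1..int n} \<or> - k \<in> {1..int n}" by (auto simp: alphabet_def)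
  then show ?thesis
    using k B_minus[OF assms(1), of k] by (metis image_eqI list.set_map set_upto window_def)
qed

lemma coord_minus: "coord v (- i) = - coord v i"
  by (simp add: coord_def sgn_minus)

lemma coord_act_window:
  assumes "\<sigma> \<in> B n" "k < n"
  shows "coord (act n lam \<sigma>) (\<sigma> (int k + 1)) = lam ! k"
proof -
  have "int k + 1 \<in> alphabet n" using assms by (simp add: alphabet_def)
  then show ?thesis
    using assms by (simp add: coord_act B_alphabet B_inv)
      (simp add: coord_def nat_add_distrib)
qed

text \<open>The right-hand side depends on \<open>n\<close> and \<open>v\<close> only, so this also
  shows that at most one reduced element sends \<open>lam\<close> to \<open>v\<close>.\<close>

lemma window_eq_read_once:
  assumes n: "1 \<le> n" and lam: "is_partition n lam" and s: "\<sigma> \<in> B n"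
    and v: "act n lam \<sigma> = v" and red: "reduced n lam \<sigma>"
  shows "window n \<sigma> = read_once (reading_word ([1..int n] # key_tableau n v))"
proof -
  define w where "w = window n \<sigma>"
  have fw: "coord v (w ! k) = lam ! k" if "k < n" for k
    using coord_act_window[OF s that, of lam] that unfolding v by (simp add: w_def window_nth)
  have lw: "length w = n" by (simp add: w_def)
  have lam_pos: "\<And>k. k < n \<Longrightarrow> 0 \<le> lam ! k"
    and lam_dec: "\<And>k l. k < l \<Longrightarrow> l < n \<Longrightarrow> lam ! l \<le> lam ! k"
    using lam by (auto simp: is_partition_def sorted_wrt_iff_nth_less)
  have f_nonneg: "0 \<le> coord v a" if "a \<in> set w" for a
    using that fw lam_pos by (auto simp: in_set_conv_nth lw)
  let ?R = "\<lambda>a b. coord v b < coord v a \<or> coord v a = coord v b \<and> letter_pos n a < letter_pos n b"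
  have tr: "transp ?R" by (rule transpI) auto
  \<comment> \<open>By transitivity only adjacent positions matter: where \<open>lam\<close> drops
    the coordinate decides, where it is constant the absence of a descent does.\<close>
  have sorted_w: "sorted_wrt ?R w"
  proof (subst sorted_wrt_iff_nth_Suc_transp[OF tr], intro allI impI)
    fix k assume "Suc k < length w"
    then have k: "Suc k < n" by (simp add: lw)
    show "?R (w ! k) (w ! Suc k)"
    proof (cases "lam ! k = lam ! Suc k")
      case True
      then have "\<not> descent n \<sigma> (Suc k)" using red k by (auto simp: reduced_def)
      then show ?thesis
        using not_descentD[OF s, of "Suc k"] k True fw[of k] fw[of "Suc k"]
        by (simp add: w_def window_nth add_ac)
    next
      case False
      then show ?thesis using lam_dec[of k "Suc k"] k fw[of k] fw[of "Suc k"] by simp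
    qed
  qed
  have walph: "a \<in> alphabet n" if "a \<in> set w" for a
    using set_window_alphabet[OF s] that by (auto simp: w_def)
  \<comment> \<open>A coordinate 0 forces the last entry of \<open>lam\<close> to be 0, so the last
    letter of the window is positive. The letter \<open>a\<close> lies in the same block, hence
    weakly precedes it in the alphabet and is positive too.\<close>
  have zero_pos: "0 < a" if a: "a \<in> set w" "coord v a = 0" for a
  proof -
    obtain k where k: "k < n" "a = w ! k" using a by (auto simp: in_set_conv_nth lw)
    have "lam ! (n - 1) = 0"
      using k a fw[of k] lam_dec[of k "n - 1"] lam_pos[of "n - 1"] n by (cases "k = n - 1") auto
    then have "\<not> descent n \<sigma> n" using red by (simp add: reduced_def)
    then have last: "0 \<le> w ! (n - 1)"
      using descent_last_iff[OF s n] n by (simp add: w_def window_nth)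
    have "w ! (n - 1) \<in> alphabet n" using walph lw n by simp
    with last have last: "0 < w ! (n - 1)" "w ! (n - 1) \<le> int n" by (auto simp: alphabet_def)
    show ?thesis
    proof (cases "k = n - 1")
      case False
      then have "?R (w ! k) (w ! (n - 1))"
        using sorted_w k n by (simp add: sorted_wrt_iff_nth_less lw)
      then have "letter_pos n a < letter_pos n (w ! (n - 1))"
        using a k fw[of "n - 1"] \<open>lam ! (n - 1) = 0\<close> n by simp
      then show ?thesis using last walph[OF a(1)]
        by (auto simp: letter_pos_def alphabet_def split: if_splits)
    qed (use last k in simp)
  qed
  have dw: "distinct (map abs w)" by (simp add: w_def distinct_abs_window s)
  \<comment> \<open>Of \<open>i\<close> and \<open>- i\<close> the window contains one with
    nonnegative coordinate; when the coordinate is nonzero, this is the sign chosen by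
    \<open>key_column\<close>.\<close>
  have set_col: "set (key_column n v j) = {a \<in> set w. j \<le> coord v a}" if "1 \<le> j" for j
  proof (intro set_eqI iffI)
    fix a assume "a \<in> set (key_column n v j)"
    then obtain i where i: "1 \<le> i" "i \<le> int n" "j \<le> \<bar>coord v i\<bar>" "a = sgn (coord v i) * i"
      by (auto simp: key_column_def)
    then have "i \<in> alphabet n" by (simp add: alphabet_def)
    then have "i \<in> set w \<or> - i \<in> set w" using window_or_minus[OF s] by (simp add: w_def)
    then show "a \<in> {a \<in> set w. j \<le> coord v a}"
      using i that f_nonneg[of i] f_nonneg[of "- i"]
      by (auto simp: coord_minus sgn_if abs_if split: if_splits)
  next
    fix a assume a: "a \<in> {a \<in> set w. j \<le> coord v a}"
    then have "a \<in> alphabet n" using walph by simp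
    then have "\<bar>a\<bar> \<in> {1..int n}" "a = sgn (coord v \<bar>a\<bar>) * \<bar>a\<bar>" "\<bar>coord v \<bar>a\<bar>\<bar> = coord v a"
      using a that by (auto simp: alphabet_def abs_if coord_minus sgn_if)
    then show "a \<in> set (key_column n v j)" using a
      by (auto simp: key_column_def intro!: image_eqI[of _ _ "\<bar>a\<bar>"])
  qed
  have sorted_col: "sorted_wrt (\<lambda>a b. letter_pos n a < letter_pos n b) (key_column n v j)"
    and distinct_col: "distinct (map abs (key_column n v j))" if "1 \<le> j" for j
  proof -
    \<comment> \<open>As \<open>1 \<le> j\<close>, no sign is 0 here. Distinctness then upgrades the
      weak order given by \<open>sort_key\<close> to a strict one.\<close>
    have "inj_on (\<lambda>i. sgn (coord v i) * i) (set (filter (\<lambda>i. j \<le> \<bar>coord v i\<bar>) [1..int n]))"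
      using that by (auto simp: inj_on_def sgn_if split: if_splits)
    then have d: "distinct (key_column n v j)"
      by (simp add: key_column_def distinct_map)
    have sub: "set (key_column n v j) \<subseteq> set w" using set_col[OF that] by auto
    then show "distinct (map abs (key_column n v j))"
      using d dw by (auto simp: distinct_map intro: inj_on_subset)
    have "inj_on (letter_pos n) (set (key_column n v j))"
      using sub walph letter_pos_inj by (blast intro: inj_onI)
    then have "sorted_wrt (<) (map (letter_pos n) (key_column n v j))"
      using d by (simp add: strict_sorted_iff distinct_map) (simp add: key_column_def)
    then show "sorted_wrt (\<lambda>a b. letter_pos n a < letter_pos n b) (key_column n v j)"
      by (simp add: sorted_wrt_map)
  qed
  define m where "m = Max (insert 0 (abs ` set v))"
  have "0 \<le> m" by (simp add: m_def)
  have "length v = n" using v by auto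
  have f_le: "coord v a \<le> m" if "a \<in> set w" for a
  proof -
    have "\<bar>v ! (nat \<bar>a\<bar> - 1)\<bar> \<le> m" unfolding m_def
      using walph[OF that] \<open>length v = n\<close> by (intro Max_ge) (auto simp: alphabet_def)
    then show ?thesis by (auto simp: coord_def sgn_if)
  qed
  \<comment> \<open>Downward induction from \<open>m + 1\<close>, where no column is left. It runs
    through all smaller integers, so the guard \<open>1 \<le> j\<close> stays inside the
    claim.\<close>
  have "1 \<le> j \<longrightarrow> read_once (concat (rev (map (key_column n v) [j..m])))
      = filter (\<lambda>a. j \<le> coord v a) w" if "j \<le> m + 1" for j
    using that
  proof (induction j rule: int_le_induct)
    case base
    have "filter (\<lambda>a. m + 1 \<le> coord v a) w = []" using f_le by (fastforce simp: filter_empty_conv)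
    then show ?case by simp
  next
    case (step j)
    show ?case
    proof
      assume j: "1 \<le> j - 1"
      have "read_once (concat (rev (map (key_column n v) [j..m])) @ key_column n v (j - 1))
          = filter (\<lambda>a. j - 1 \<le> coord v a) w"
        by (rule read_once_append_column[OF sorted_w dw])
          (use step j in \<open>auto simp: sorted_col distinct_col set_col\<close>)
      then show "read_once (concat (rev (map (key_column n v) [j - 1..m])))
          = filter (\<lambda>a. j - 1 \<le> coord v a) w"
        using step.hyps by (simp add: upto_rec1[of "j - 1" m])
    qed
  qed
  from this[of 1] have cols: "read_once (concat (rev (key_tableau n v)))
      = filter (\<lambda>a. 0 + 1 \<le> coord v a) w"
    using \<open>0 \<le> m\<close> by (simp add: key_tableau_def m_def)
  \<comment> \<open>The added column is read last and acts as the column for \<open>j = 0\<close>: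
    its unread letters are those of coordinate 0, which occur positively in the window.\<close>
  have "read_once (concat (rev (key_tableau n v)) @ [1..int n]) = filter (\<lambda>a. 0 \<le> coord v a) w"
  proof (rule read_once_append_column[OF sorted_w dw cols])
    show "sorted_wrt (\<lambda>a b. letter_pos n a < letter_pos n b) [1..int n]"
      by (rule sorted_wrt_mono_rel[of _ "(<)"]) (auto simp: letter_pos_def)
    show "distinct (map abs [1..int n])" by (simp add: distinct_map inj_on_def)
    fix a assume a: "coord v a \<le> 0 \<or> a \<notin> set w" "\<bar>a\<bar> \<notin> abs ` {b \<in> set w. 0 + 1 \<le> coord v b}"
    show "a \<in> set [1..int n] \<longleftrightarrow> a \<in> set w \<and> coord v a = 0"
    proof
      assume "a \<in> set [1..int n]"
      then have pos: "0 < a" "a \<in> alphabet n" by (auto simp: alphabet_def)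
      then obtain b where b: "b \<in> set w" "\<bar>b\<bar> = \<bar>a\<bar>"
        using window_or_minus[OF s, of a] by (auto simp: w_def)
      then have "coord v b = 0" using a(2) f_nonneg[of b] by (force simp: image_iff)
      then have "b = a" using zero_pos[OF b(1)] b(2) pos by simp
      then show "a \<in> set w \<and> coord v a = 0" using b \<open>coord v b = 0\<close> by simp
    next
      assume "a \<in> set w \<and> coord v a = 0"
      then have "0 < a" "a \<in> alphabet n" using zero_pos walph by auto
      then show "a \<in> set [1..int n]" by (simp add: alphabet_def)
    qed
  qed
  moreover have "filter (\<lambda>a. 0 \<le> coord v a) w = w" using f_nonneg by simp
  ultimately show ?thesis by (simp add: reading_word_def w_def)
qed

section \<open>Minimal coset representatives\<close>

lemma B_eqI:
  assumes "\<sigma> \<in> B n" "\<tau> \<in> B n" "window n \<sigma> = window n \<tau>"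
  shows "\<sigma> = \<tau>"
proof
  fix i
  have pos: "\<sigma> k = \<tau> k" if "1 \<le> k" "k \<le> int n" for k
    using assms(3) that by (simp add: window_def)
  show "\<sigma> i = \<tau> i"
  proof (cases "i \<in> alphabet n")
    case True
    then have "1 \<le> i \<and> i \<le> int n \<or> 1 \<le> - i \<and> - i \<le> int n" by (auto simp: alphabet_def)
    then show ?thesis
      using pos[of i] pos[of "- i"] assms(1,2) by (auto simp: B_minus)
  next
    case False
    then show ?thesis using assms(1,2) by (simp add: B_not_in)
  qed
qed

lemma id_in_B: "id \<in> B n"
  by (simp add: B_def)

text \<open>All of \<open>B n\<close> fixes the zero vector, and for this vector an element without
  descents is reduced, as is \<open>id\<close>. Both then have the same window.\<close>

lemma ex_descent:
  assumes "1 \<le> n" "\<sigma> \<in> B n" "\<sigma> \<noteq> id"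
  shows "\<exists>i\<in>{1..n}. descent n \<sigma> i"
proof (rule ccontr)
  let ?z = "replicate n 0 :: int list"
  assume "\<not> ?thesis"
  then have "reduced n ?z \<sigma>" using assms(1) by (auto simp: reduced_def)
  moreover have "reduced n ?z id"
    by (auto simp: reduced_def descent_def next_letter_def letter_pos_def)
  moreover have "is_partition n ?z"
    by (auto simp: is_partition_def sorted_wrt_iff_nth_less)
  moreover have "act n ?z \<tau> = ?z" if "\<tau> \<in> B n" for \<tau>
  proof (rule nth_equalityI)
    fix k assume "k < length (act n ?z \<tau>)"
    then have k: "k < n" by simp
    then have "inv \<tau> (int k + 1) \<in> alphabet n"
      using B_permutes[OF that, THEN permutes_inv, THEN permutes_in_image, of "int k + 1"]
      by (simp add: alphabet_def)
    then show "act n ?z \<tau> ! k = ?z ! k"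
      using k by (auto simp: act_nth coord_def alphabet_def)
  qed simp
  ultimately have "window n \<sigma> = window n id"
    using window_eq_read_once[OF assms(1)] assms(2) id_in_B by metis
  then show False using B_eqI assms(2,3) id_in_B by blast
qed

text \<open>Removing a descent lowers the weight, so the process ends at \<open>id\<close>. This
  ensures that the \<open>LEAST\<close> in \<open>cox_length\<close> is attained by a word.\<close>

lemma B_generated:
  assumes "1 \<le> n" "\<sigma> \<in> B n"
  shows "\<exists>ws. set ws \<subseteq> {1..n} \<and> word_prod n ws = \<sigma>"
  using assms(2)
proof (induction "nat (weight n \<sigma>)" arbitrary: \<sigma> rule: less_induct)
  case less
  show ?case
  proof (cases "\<sigma> = id")
    case True
    then show ?thesis by (intro exI[of _ "[]"]) (simp add: word_prod_def id_def)
  next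
    case False
    then obtain i where i: "1 \<le> i" "i \<le> n" "descent n \<sigma> i"
      using ex_descent[OF assms(1) less.prems] by auto
    have B: "\<sigma> \<circ> gen n i \<in> B n" using i less.prems by (intro B_comp gen_in_B)
    then obtain ws where "set ws \<subseteq> {1..n}" "word_prod n ws = \<sigma> \<circ> gen n i"
      using less.hyps[OF _ B] weight_less[OF less.prems i] weight_nonneg[OF B] by auto
    then show ?thesis using i gen_involution[of i n]
      by (intro exI[of _ "i # ws"]) (auto simp: word_prod_Cons comp_assoc)
  qed
qed

text \<open>In a shortest word for \<sigma>, deletion applied to \<open>int i\<close> and its
  successor removes one generator, since \<open>gen n i\<close> is their reflection.\<close>

lemma cox_length_less:
  assumes "1 \<le> n" "\<sigma> \<in> B n" "1 \<le> i" "i \<le> n" "descent n \<sigma> i"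
  shows "cox_length n (\<sigma> \<circ> gen n i) < cox_length n \<sigma>"
proof -
  let ?P = "\<lambda>\<sigma> k. \<exists>ws. length ws = k \<and> set ws \<subseteq> {1..n} \<and> word_prod n ws = \<sigma>"
  have "\<exists>k. ?P \<sigma> k" using B_generated[OF assms(1,2)] by blast
  then have "?P \<sigma> (cox_length n \<sigma>)" unfolding cox_length_def by (rule LeastI_ex)
  then obtain ws where ws: "length ws = cox_length n \<sigma>" "set ws \<subseteq> {1..n}" "word_prod n ws = \<sigma>"
    by blast
  have "letter_pos n (int i) < letter_pos n (next_letter n i)"
    using assms(3,4) by (auto simp: letter_pos_def next_letter_def)
  then obtain us where "Suc (length us) = length ws" "set us \<subseteq> {1..n}"
    "word_prod n us = \<sigma> \<circ> gen n i"
    using word_deletion[OF ws(2) nat_in_alphabet next_letter_in_alphabet, of i i] assms ws(3)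
    by (auto simp: descent_def gen_eq_reflection)
  then have "cox_length n (\<sigma> \<circ> gen n i) \<le> length us"
    unfolding cox_length_def by (intro Least_le) blast
  then show ?thesis using ws(1) \<open>Suc (length us) = length ws\<close> by simp
qed

text \<open>If \<open>gen n i\<close> fixes \<open>lam\<close>, applying it before \<sigma> stays in
  the coset; at a descent the result would be shorter.\<close>

lemma reduced_if_arg_min:
  assumes n: "1 \<le> n" and len: "length lam = n"
    and min: "is_arg_min (cox_length n) (\<lambda>\<sigma>. \<sigma> \<in> B n \<and> act n lam \<sigma> = v) \<sigma>"
  shows "reduced n lam \<sigma>"
proof -
  have s: "\<sigma> \<in> B n" "act n lam \<sigma> = v" using min by (auto simp: is_arg_min_def)
  have no_descent: "\<not> descent n \<sigma> i" if i: "1 \<le> i" "i \<le> n" "act n lam (gen n i) = lam" for i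
  proof
    assume "descent n \<sigma> i"
    then have "cox_length n (\<sigma> \<circ> gen n i) < cox_length n \<sigma>"
      using cox_length_less n s i by blast
    moreover have "\<sigma> \<circ> gen n i \<in> B n" "act n lam (\<sigma> \<circ> gen n i) = v"
      using i s by (auto intro: B_comp gen_in_B simp: act_comp gen_in_B)
    ultimately show False using min by (auto simp: is_arg_min_def)
  qed
  show ?thesis unfolding reduced_def
  proof (intro conjI allI impI)
    fix i assume i: "1 \<le> i" "i < n" "lam ! (i - 1) = lam ! i"
    have "act n lam (gen n i) = lam"
      using act_gen[OF len i(1,2)] i(3) by (metis list_update_id)
    then show "\<not> descent n \<sigma> i" using no_descent i by simp
  next
    assume "lam ! (n - 1) = 0"
    then have "act n lam (gen n n) = lam"
      using act_gen_last[OF len n] by (metis list_update_id neg_equal_zero)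
    then show "\<not> descent n \<sigma> n" using no_descent n by simp
  qed
qed

theorem proposition5:
  fixes n :: nat and lam v :: "int list"
  assumes "1 \<le> n"
    and "is_partition n lam"
    and "v \<in> orbit n lam"
  shows "window n (min_rep n lam v) = read_once (reading_word ([1..int n] # key_tableau n v))"
proof -
  let ?P = "\<lambda>\<sigma>. \<sigma> \<in> B n \<and> act n lam \<sigma> = v"
  have window: "window n \<sigma> = read_once (reading_word ([1..int n] # key_tableau n v))"
    if "is_arg_min (cox_length n) ?P \<sigma>" for \<sigma>
  proof (rule window_eq_read_once[OF assms(1,2)])
    show "\<sigma> \<in> B n" "act n lam \<sigma> = v" using that by (auto simp: is_arg_min_def)
    show "reduced n lam \<sigma>"
      using reduced_if_arg_min assms(1,2) that by (auto simp: is_partition_def)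
  qed
  obtain \<tau> where "?P \<tau>" using assms(3) by (auto simp: orbit_def)
  \<comment> \<open>Lengths are natural numbers, so a nonempty coset has a shortest element.\<close>
  then have ex: "is_arg_min (cox_length n) ?P (arg_min (cox_length n) ?P)"
    by (rule is_arg_min_arg_min_nat[of ?P])
  have "is_arg_min (cox_length n) ?P (min_rep n lam v)"
    unfolding min_rep_def
  \<comment> \<open>Two minimizers have the same window and are therefore equal, so
    \<open>THE\<close> is well defined.\<close>
  proof (rule theI[of "is_arg_min (cox_length n) ?P", OF ex])
    fix \<sigma> assume \<sigma>: "is_arg_min (cox_length n) ?P \<sigma>"
    then show "\<sigma> = arg_min (cox_length n) ?P"
      using window[OF \<sigma>] window[OF ex] ex by (intro B_eqI) (auto simp: is_arg_min_def)
  qed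
  then show ?thesis by (rule window)
qed

end
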